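(* Let $R$ be a finite commutative local ring with $2\in R^\times$, having a unique minimal (nonzero) ideal, with residue field of order $q$, and let $\lambda:R^+\to\mathbb C^\times$ be a primitive group homomorphism. Let $V$ be a free $R$-module of rank $2n$ ($n\ge1$) with a nondegenerate alternating form, symplectic group $\mathrm{Sp}$, and symplectic basis $u_1,\dots,u_n,v_1,\dots,v_n$, and let $X$ be a complex vector space with basis $(e_v)_{v\in N}$, where $N$ is the span of $v_1,\dots,v_n$. Suppose $q>3$. Then the unique representation $W:\mathrm{Sp}\to\mathrm{GL}(X)$ satisfying formulas (W1)–(W3) of the context is a Weil representation of type $\lambda$, that is, $$W(g)S(h)W(g)^{-1}=S({}^g h),\quad h\in H,\ g\in\mathrm{Sp},$$ where $H$ is the Heisenberg group of $V$ and $S:H\to \mathrm{GL}(X)$ is the Schrödinger representation of type $\lambda$ described in the context.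
   Context: A group homomorphism $\lambda:R^+\to\mathbb C^\times$ is primitive if its kernel contains no ideal of $R$ other than $(0)$. Let $|R|=q^d$. The homomorphism $\mu:R^\times\to\{1,-1\}$ is trivial if $d$ is even; if $d$ is odd, $\mu(r)=1$ when $r$ is a square in $R^\times$ and $\mu(r)=-1$ otherwise. $G(\lambda)=\sum_{r\in R}\lambda(r^2)$ (nonzero). The alternating form $\langle\ ,\ \rangle:V\times V\to R$ is nondegenerate in the sense that $v\mapsto\langle v,-\rangle$ is an isomorphism $V\to\mathrm{Hom}_R(V,R)$; $\mathrm{Sp}=\mathrm{Sp}(2n,R)$ is the group of $R$-linear automorphisms preserving it. The basis is symplectic: $\langle u_i,v_j\rangle=\delta_{ij}$, $\langle u_i,u_j\rangle=0=\langle v_i,v_j\rangle$. $M$ and $N$ are the spans of the $u_i$ and of the $v_i$. $\mathrm{Sp}_{M,N}=\{g\in\mathrm{Sp}: gM=M,\ gN=N\}$, $\mathrm{Sp}^M=\{g\in\mathrm{Sp}: gu=u\ \forall u\in M\}$, and $s\in\mathrm{Sp}$ is given by $u_i\mapsto v_i$, $v_i\mapsto-u_i$. When $q>3$ there is exactly one group representation $W:\mathrm{Sp}\to\mathrm{GL}(X)$ such that for all $v\in N$: (W1) $W(g)e_v=\mu(\det g|_N)e_{gv}$ for $g\in\mathrm{Sp}_{M,N}$; (W2) $W(g)e_v=\lambda(\langle gv,v\rangle)e_v$ for $g\in\mathrm{Sp}^M$; (W3) $W(s)e_v=G(\lambda)^{-n}\sum_{w\in N}\lambda\big(-2\sum_{i=1}^n\langle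 u_i,w\rangle\langle u_i,v\rangle\big)e_w$. The Heisenberg group is $H=R\times V$ with multiplication $(r,u)(s,v)=(r+s+\langle u,v\rangle,u+v)$; $\mathrm{Sp}$ acts on $H$ by automorphisms via ${}^g(r,u)=(r,gu)$. The Schrödinger representation $S:H\to\mathrm{GL}(X)$ of type $\lambda$ (the irreducible representation, unique up to isomorphism, on which the center $(R,0)$ acts via $\lambda$) is realized as the representation of $H$ induced from the linear character $(r,u)\mapsto\lambda(r)$ of the subgroup $R\times M$, acting on $\mathbb C y$, with $e_v=(0,v)y$ for $v\in N$; explicitly, for $v\in N$: $S(0,w)e_v=e_{v+w}$ for $w\in N$, $S(0,u)e_v=\lambda(2\langle u,v\rangle)e_v$ for $u\in M$, and $S(r,0)e_v=\lambda(r)e_v$ for $r\in R$. *)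

theory Defs
  imports Complex_Main "HOL-Algebra.Group" "Jordan_Normal_Form.Determinant"
begin

(* Module notions are taken from HOL.Modules and are written with their qualified names,
   because HOL-Algebra also has theories and locales called module. *)

definition is_ideal :: "'r::comm_ring_1 set \<Rightarrow> bool" where
  "is_ideal I \<longleftrightarrow> Modules.module.subspace (*) I"

definition is_maximal_ideal :: "'r::comm_ring_1 set \<Rightarrow> bool" where
  "is_maximal_ideal I \<longleftrightarrow>
     is_ideal I \<and> I \<noteq> UNIV \<and> (\<forall>J. is_ideal J \<and> I \<subseteq> J \<longrightarrow> J = I \<or> J = UNIV)"

definition is_minimal_ideal :: "'r::comm_ring_1 set \<Rightarrow> bool" where
  "is_minimal_ideal I \<longleftrightarrow>
     is_ideal I \<and> I \<noteq> {0} \<and> (\<forall>J. is_ideal J \<and> J \<subseteq> I \<longrightarrow> J = {0} \<or> J = I)"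

definition quotient_set :: "'r::comm_ring_1 set \<Rightarrow> 'r set set" where
  "quotient_set I = UNIV // {(a, b). a - b \<in> I}"

definition primitive_char :: "('r::comm_ring_1 \<Rightarrow> complex) \<Rightarrow> bool" where
  "primitive_char lam \<longleftrightarrow>
     (\<forall>a. lam a \<noteq> 0) \<and> (\<forall>a b. lam (a + b) = lam a * lam b) \<and>
     (\<forall>I. is_ideal I \<and> I \<subseteq> {a. lam a = 1} \<longrightarrow> I = {0})"

(* Only used at units r; d is the exponent in card R = q ^ d. *)
definition mu :: "nat \<Rightarrow> 'r::comm_ring_1 \<Rightarrow> complex" where
  "mu d r = (if even d \<or> (\<exists>t. t dvd 1 \<and> r = t ^ 2) then 1 else - 1)"

definition gauss_sum :: "('r::{comm_ring_1,finite} \<Rightarrow> complex) \<Rightarrow> complex" where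
  "gauss_sum lam = (\<Sum>r\<in>UNIV. lam (r ^ 2))"

definition nondegenerate_alternating ::
  "('r::comm_ring_1 \<Rightarrow> 'v::ab_group_add \<Rightarrow> 'v) \<Rightarrow> ('v \<Rightarrow> 'v \<Rightarrow> 'r) \<Rightarrow> bool" where
  "nondegenerate_alternating scl form \<longleftrightarrow>
     (\<forall>x. Modules.module_hom scl (*) (\<lambda>y. form x y)) \<and>
     (\<forall>y. Modules.module_hom scl (*) (\<lambda>x. form x y)) \<and>
     (\<forall>x. form x x = 0) \<and>
     bij_betw (\<lambda>x. form x) UNIV {f. Modules.module_hom scl (*) f}"

(* The cardinality condition says that u 0, ..., u (n-1), v 0, ..., v (n-1) are distinct. *)
definition symplectic_basis ::
  "('r::comm_ring_1 \<Rightarrow> 'v::ab_group_add \<Rightarrow> 'v) \<Rightarrow> ('v \<Rightarrow> 'v \<Rightarrow> 'r) \<Rightarrow> nat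
     \<Rightarrow> (nat \<Rightarrow> 'v) \<Rightarrow> (nat \<Rightarrow> 'v) \<Rightarrow> bool" where
  "symplectic_basis scl form n u v \<longleftrightarrow>
     card (u ` {..<n} \<union> v ` {..<n}) = 2 * n \<and>
     \<not> Modules.module.dependent scl (u ` {..<n} \<union> v ` {..<n}) \<and>
     Modules.module.span scl (u ` {..<n} \<union> v ` {..<n}) = UNIV \<and>
     (\<forall>i<n. \<forall>j<n. form (u i) (v j) = (if i = j then 1 else 0) \<and>
        form (u i) (u j) = 0 \<and> form (v i) (v j) = 0)"

definition GL :: "('k::comm_ring_1 \<Rightarrow> 'm::ab_group_add \<Rightarrow> 'm) \<Rightarrow> ('m \<Rightarrow> 'm) monoid" where
  "GL scl = \<lparr>carrier = {f. Modules.module_hom scl scl f \<and> bij f}, mult = (\<circ>), one = id\<rparr>"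

definition Sp ::
  "('r::comm_ring_1 \<Rightarrow> 'v::ab_group_add \<Rightarrow> 'v) \<Rightarrow> ('v \<Rightarrow> 'v \<Rightarrow> 'r) \<Rightarrow> ('v \<Rightarrow> 'v) monoid" where
  "Sp scl form =
     (GL scl)\<lparr>carrier := {g \<in> carrier (GL scl). \<forall>x y. form (g x) (g y) = form x y}\<rparr>"

definition Sp_stab ::
  "('r::comm_ring_1 \<Rightarrow> 'v::ab_group_add \<Rightarrow> 'v) \<Rightarrow> ('v \<Rightarrow> 'v \<Rightarrow> 'r) \<Rightarrow> 'v set \<Rightarrow> 'v set \<Rightarrow> ('v \<Rightarrow> 'v) set" where
  "Sp_stab scl form M N = {g \<in> carrier (Sp scl form). g ` M = M \<and> g ` N = N}"

definition Sp_fix ::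
  "('r::comm_ring_1 \<Rightarrow> 'v::ab_group_add \<Rightarrow> 'v) \<Rightarrow> ('v \<Rightarrow> 'v \<Rightarrow> 'r) \<Rightarrow> 'v set \<Rightarrow> ('v \<Rightarrow> 'v) set" where
  "Sp_fix scl form M = {g \<in> carrier (Sp scl form). \<forall>x\<in>M. g x = x}"

(* Determinant of an endomorphism g of the span of the basis v 0, ..., v (n-1);
   column j holds the coordinates of g (v j). *)
definition det_on ::
  "('r::comm_ring_1 \<Rightarrow> 'v::ab_group_add \<Rightarrow> 'v) \<Rightarrow> nat \<Rightarrow> (nat \<Rightarrow> 'v) \<Rightarrow> ('v \<Rightarrow> 'v) \<Rightarrow> 'r" where
  "det_on scl n v g =
     det (mat n n (\<lambda>(i, j). Modules.module.representation scl (v ` {..<n}) (g (v j)) (v i)))"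

definition W_formulas ::
  "nat \<Rightarrow> ('r::{comm_ring_1,finite} \<Rightarrow> complex) \<Rightarrow> ('r \<Rightarrow> 'v::ab_group_add \<Rightarrow> 'v) \<Rightarrow> ('v \<Rightarrow> 'v \<Rightarrow> 'r)
     \<Rightarrow> nat \<Rightarrow> (nat \<Rightarrow> 'v) \<Rightarrow> (nat \<Rightarrow> 'v) \<Rightarrow> 'v set \<Rightarrow> 'v set \<Rightarrow> ('v \<Rightarrow> 'v)
     \<Rightarrow> (complex \<Rightarrow> 'x::ab_group_add \<Rightarrow> 'x) \<Rightarrow> ('v \<Rightarrow> 'x) \<Rightarrow> (('v \<Rightarrow> 'v) \<Rightarrow> 'x \<Rightarrow> 'x) \<Rightarrow> bool" where
  "W_formulas d lam scl form n u v M N s sclX e W \<longleftrightarrow>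
     (\<forall>x\<in>N.
        (\<forall>g\<in>Sp_stab scl form M N. W g (e x) = sclX (mu d (det_on scl n v g)) (e (g x))) \<and>
        (\<forall>g\<in>Sp_fix scl form M. W g (e x) = sclX (lam (form (g x) x)) (e x)) \<and>
        W s (e x) = sclX (inverse (gauss_sum lam ^ n))
          (\<Sum>w\<in>N. sclX (lam (- 2 * (\<Sum>i<n. form (u i) w * form (u i) x))) (e w)))"

definition heisenberg :: "('v::ab_group_add \<Rightarrow> 'v \<Rightarrow> 'r::comm_ring_1) \<Rightarrow> ('r \<times> 'v) monoid" where
  "heisenberg form =
     \<lparr>carrier = UNIV,
      mult = (\<lambda>(r, x) (t, y). (r + t + form x y, x + y)),
      one = (0, 0)\<rparr>"

definition heisenberg_act :: "('v \<Rightarrow> 'v) \<Rightarrow> 'r \<times> 'v \<Rightarrow> 'r \<times> 'v" where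
  "heisenberg_act g = (\<lambda>(r, x). (r, g x))"

(* As (0, w), (0, m) and (r, 0) with w in N, m in M generate the Heisenberg group and the
   e x span the space, these conditions determine S. *)
definition schroedinger_rep ::
  "('r::comm_ring_1 \<Rightarrow> complex) \<Rightarrow> ('v::ab_group_add \<Rightarrow> 'v \<Rightarrow> 'r) \<Rightarrow> 'v set \<Rightarrow> 'v set
     \<Rightarrow> (complex \<Rightarrow> 'x::ab_group_add \<Rightarrow> 'x) \<Rightarrow> ('v \<Rightarrow> 'x) \<Rightarrow> ('r \<times> 'v \<Rightarrow> 'x \<Rightarrow> 'x) \<Rightarrow> bool" where
  "schroedinger_rep lam form M N sclX e S \<longleftrightarrow>
     S \<in> hom (heisenberg form) (GL sclX) \<and>
     (\<forall>x\<in>N.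
        (\<forall>w\<in>N. S (0, w) (e x) = e (x + w)) \<and>
        (\<forall>m\<in>M. S (0, m) (e x) = sclX (lam (2 * form m x)) (e x)) \<and>
        (\<forall>r. S (r, 0) (e x) = sclX (lam r) (e x)))"

definition weil_rep ::
  "('r::comm_ring_1 \<Rightarrow> 'v::ab_group_add \<Rightarrow> 'v) \<Rightarrow> ('v \<Rightarrow> 'v \<Rightarrow> 'r) \<Rightarrow> (complex \<Rightarrow> 'x::ab_group_add \<Rightarrow> 'x)
     \<Rightarrow> ('r \<times> 'v \<Rightarrow> 'x \<Rightarrow> 'x) \<Rightarrow> (('v \<Rightarrow> 'v) \<Rightarrow> 'x \<Rightarrow> 'x) \<Rightarrow> bool" where
  "weil_rep scl form sclX S W \<longleftrightarrow>
     W \<in> hom (Sp scl form) (GL sclX) \<and>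
     (\<forall>g\<in>carrier (Sp scl form). \<forall>h\<in>carrier (heisenberg form).
        W g \<otimes>\<^bsub>GL sclX\<^esub> S h \<otimes>\<^bsub>GL sclX\<^esub> inv\<^bsub>GL sclX\<^esub> (W g) = S (heisenberg_act g h))"

end

theory Submission
  imports Defs
begin

text \<open>
  Call \<open>g\<close> good if \<open>W(g) S(h) = S(\<^sup>gh) W(g)\<close> for all \<open>h\<close>. As \<open>W\<close> is a homomorphism and
  \<open>Sp\<close> acts on the Heisenberg group by automorphisms, the good elements form a subgroup of \<open>Sp\<close>
  (lemma \<open>subgroup_intertwines\<close>). It therefore suffices to find good elements that generate \<open>Sp\<close>.
  Over a local ring the fixator of \<open>M\<close> together with \<open>s\<close> is enough, for the following reasons.

  \<^item> For \<open>g\<close> in the fixator of \<open>M\<close> and for \<open>g = s\<close>, the intertwining relation is an identity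
    between explicit operators. The Heisenberg group is generated by its centre, \<open>N\<close> and \<open>M\<close>, and the
    vectors \<open>e x\<close> span, so it need only be checked for \<open>h\<close> in \<open>N\<close> or \<open>M\<close> on a vector \<open>e x\<close>. There it
    amounts to the additivity of \<open>lam\<close> and to \<open>g\<close> preserving the form (lemmas
    \<open>intertwines_Sp_fix\<close> and \<open>intertwines_swap\<close>).

  \<^item> Let \<open>G\<close> be a subgroup of \<open>Sp\<close> that contains the fixator of \<open>M\<close> and \<open>s\<close>. The transvection along
    \<open>z\<close> fixes \<open>M\<close> when \<open>z\<close> is in \<open>M\<close>, and conjugating it by \<open>g\<close> gives the transvection along \<open>g z\<close>. If
    \<open>z\<close> is unimodular, one of its coordinates is a unit because the ring is local; with \<open>s\<close> and a
    Siegel transformation from the fixator of \<open>M\<close>, the vector \<open>z\<close> can then be moved into \<open>N\<close> and on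
    into \<open>M\<close>. So \<open>G\<close> contains all transvections along unimodular vectors (lemma \<open>transvection_in\<close>).

  \<^item> If \<open>form y x\<close> is a unit, a transvection along \<open>y - x\<close> carries \<open>x\<close> to \<open>y\<close>. In general an
    intermediate vector is needed, and over a local ring one is always available. In this way products
    of transvections carry any hyperbolic pair to any other and fix the vectors orthogonal to both
    (lemma \<open>hyperbolic_pair_transitive\<close>). Restoring the pairs \<open>(g (u i), g (v i))\<close> to
    \<open>(u i, v i)\<close> one after the other shows that \<open>g\<close> is in \<open>G\<close>
    (lemma \<open>basis_stabilizer_in\<close>).
\<close>

section \<open>Symplectic modules\<close>

locale symplectic_module = Modules.module scl
  for scl :: "'r::comm_ring_1 \<Rightarrow> 'v::ab_group_add \<Rightarrow> 'v" +
  fixes form :: "'v \<Rightarrow> 'v \<Rightarrow> 'r" and n :: nat and u v :: "nat \<Rightarrow> 'v"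
  assumes nondegenerate: "nondegenerate_alternating scl form"
    and basis: "symplectic_basis scl form n u v"
begin

abbreviation "M \<equiv> span (u ` {..<n})"
abbreviation "N \<equiv> span (v ` {..<n})"

lemma form_hom: "Modules.module_hom scl (*) (form x)" "Modules.module_hom scl (*) (\<lambda>x. form x y)"
  using nondegenerate unfolding nondegenerate_alternating_def by auto

lemma form_self [simp]: "form x x = 0"
  using nondegenerate unfolding nondegenerate_alternating_def by auto

lemma form_simps:
  "form (x + y) z = form x z + form y z"  "form z (x + y) = form z x + form z y"
  "form (x - y) z = form x z - form y z"  "form z (x - y) = form z x - form z y"
  "form (- x) z = - form x z"  "form z (- x) = - form z x"
  "form (scl a x) z = a * form x z"  "form z (scl a x) = a * form z x"
  "form 0 z = 0"  "form z 0 = 0"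
  using form_hom(2)[THEN module_hom.add] form_hom(1)[THEN module_hom.add]
    form_hom(2)[THEN module_hom.diff] form_hom(1)[THEN module_hom.diff]
    form_hom(2)[THEN module_hom.neg] form_hom(1)[THEN module_hom.neg]
    form_hom(2)[THEN module_hom.scale] form_hom(1)[THEN module_hom.scale]
    form_hom(2)[THEN module_hom.zero] form_hom(1)[THEN module_hom.zero]
  by auto

lemma form_sum:
  "form (sum f I) z = (\<Sum>i\<in>I. form (f i) z)"  "form z (sum f I) = (\<Sum>i\<in>I. form z (f i))"
  using module_hom.sum[OF form_hom(2)] module_hom.sum[OF form_hom(1)] by auto

lemma form_commute: "form x y = - form y x"
proof -
  have "form (x + y) (x + y) = form x x + form x y + form y x + form y y"
    by (simp only: form_simps add_ac)
  hence "form x y + form y x = 0" by simp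
  thus ?thesis by (simp add: eq_neg_iff_add_eq_0)
qed

lemma form_eqD: "(\<And>y. form x y = form x' y) \<Longrightarrow> x = x'"
  using nondegenerate unfolding nondegenerate_alternating_def bij_betw_def
  by (metis ext injD)

lemma form_basis:
  assumes "i < n" "j < n"
  shows "form (u i) (v j) = (if i = j then 1 else 0)" "form (v i) (u j) = (if i = j then -1 else 0)"
    "form (u i) (u j) = 0" "form (v i) (v j) = 0"
  using basis assms form_commute[of "v i" "u j"] unfolding symplectic_basis_def by auto

lemma span_basis: "span (u ` {..<n} \<union> v ` {..<n}) = UNIV"
  using basis unfolding symplectic_basis_def by auto

lemma basis_eqI:
  assumes "\<And>i. i < n \<Longrightarrow> form (u i) x = form (u i) x'" "\<And>i. i < n \<Longrightarrow> form (v i) x = form (v i) x'"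
  shows "x = x'"
proof (rule form_eqD)
  fix y
  have "y \<in> span (u ` {..<n} \<union> v ` {..<n})" by (simp add: span_basis)
  hence "form y x = form y x'"
    by (induct rule: span_induct_alt) (use assms in \<open>auto simp: form_simps\<close>)
  thus "form x y = form x' y" using form_commute by metis
qed

lemma symplectic_expansion:
  "x = (\<Sum>i<n. scl (form x (v i)) (u i)) + (\<Sum>i<n. scl (form (u i) x) (v i))"
proof (rule basis_eqI)
  fix j assume j: "j < n"
  let ?x = "(\<Sum>i<n. scl (form x (v i)) (u i)) + (\<Sum>i<n. scl (form (u i) x) (v i))"
  have "form (u j) ?x = (\<Sum>i<n. if i = j then form (u i) x else 0)"
    unfolding form_simps form_sum using j by (simp add: form_basis if_distrib cong: if_cong)
  thus "form (u j) x = form (u j) ?x" using j by simp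
  have "form (v j) ?x = (\<Sum>i<n. if i = j then form (v i) x else 0)"
    unfolding form_simps form_sum using j form_commute[of x]
    by (simp add: form_basis if_distrib cong: if_cong)
  thus "form (v j) x = form (v j) ?x" using j by simp
qed

lemma basis_in_span: "i < n \<Longrightarrow> u i \<in> M" "i < n \<Longrightarrow> v i \<in> N"
  by (simp_all add: span_base)

lemma form_span_eq_0:
  assumes "\<And>a b. a \<in> A \<Longrightarrow> b \<in> B \<Longrightarrow> form a b = 0" "x \<in> span A" "y \<in> span B"
  shows "form x y = 0"
  using assms(2)
proof (induct rule: span_induct_alt)
  case (step c a z)
  have "form a y = 0"
    using assms(3) by (induct rule: span_induct_alt) (use assms(1) step in \<open>auto simp: form_simps\<close>)
  thus ?case using step by (simp add: form_simps)
qed (simp add: form_simps)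

lemma form_M_M: "x \<in> M \<Longrightarrow> y \<in> M \<Longrightarrow> form x y = 0"
  by (rule form_span_eq_0) (auto simp: form_basis)

lemma form_N_N: "x \<in> N \<Longrightarrow> y \<in> N \<Longrightarrow> form x y = 0"
  by (rule form_span_eq_0) (auto simp: form_basis)

lemma M_N_decomposition:
  obtains m w where "m \<in> M" "w \<in> N" "x = m + w"
proof (rule that)
  show "(\<Sum>i<n. scl (form x (v i)) (u i)) \<in> M" "(\<Sum>i<n. scl (form (u i) x) (v i)) \<in> N"
    by (blast intro: span_sum span_scale span_base)+
qed (rule symplectic_expansion)

lemma N_expansion: assumes "w \<in> N" shows "w = (\<Sum>i<n. scl (form (u i) w) (v i))"
  using assms symplectic_expansion[of w] by (simp add: form_N_N span_base sum.neutral)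

text \<open>The coordinates of \<open>x\<close> along the \<open>v i\<close> are its pairings with the \<open>u i\<close>, so they all vanish.\<close>

lemma M_maximal_isotropic:
  assumes "\<And>m. m \<in> M \<Longrightarrow> form m x = 0"
  shows "x \<in> M"
proof -
  have "(\<Sum>i<n. scl (form (u i) x) (v i)) = 0"
    by (rule sum.neutral) (auto simp: assms span_base)
  hence "x = (\<Sum>i<n. scl (form x (v i)) (u i))" using symplectic_expansion[of x] by simp
  moreover have "\<dots> \<in> M" by (blast intro: span_sum span_scale span_base)+
  ultimately show ?thesis by metis
qed

end

section \<open>The general linear and symplectic groups\<close>

lemma GL_carrier: "f \<in> carrier (GL scl) \<longleftrightarrow> Modules.module_hom scl scl f \<and> bij f"
  by (simp add: GL_def)

lemma GL_mult [simp]: "f \<otimes>\<^bsub>GL scl\<^esub> g = f \<circ> g"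
  by (simp add: GL_def)

lemma GL_one [simp]: "\<one>\<^bsub>GL scl\<^esub> = id"
  by (simp add: GL_def)

lemma GL_group:
  assumes "Modules.module scl"
  shows "group (GL scl)"
proof -
  interpret module_pair scl scl using assms by (simp add: module_pair_def)
  show ?thesis
  proof (rule groupI)
    fix f assume f: "f \<in> carrier (GL scl)"
    let ?g = "inv_into UNIV f"
    have "?g \<in> carrier (GL scl)"
      using f by (simp add: GL_carrier bij_module_hom_imp_inv_module_hom bij_imp_bij_inv)
    moreover have "?g \<circ> f = id" using f by (simp add: GL_carrier bij_is_inj)
    ultimately show "\<exists>g\<in>carrier (GL scl). g \<otimes>\<^bsub>GL scl\<^esub> f = \<one>\<^bsub>GL scl\<^esub>" by auto
  qed (auto simp: GL_carrier o_assoc bij_comp m1.module_hom_id intro: module_hom_compose)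
qed

context symplectic_module
begin

abbreviation "SP \<equiv> Sp scl form"

lemma Sp_carrier: "g \<in> carrier SP \<longleftrightarrow>
    Modules.module_hom scl scl g \<and> bij g \<and> (\<forall>x y. form (g x) (g y) = form x y)"
  by (simp add: Sp_def GL_def)

lemma Sp_mult [simp]: "f \<otimes>\<^bsub>SP\<^esub> g = f \<circ> g"
  by (simp add: Sp_def)

lemma Sp_one [simp]: "\<one>\<^bsub>SP\<^esub> = id"
  by (simp add: Sp_def)

lemma Sp_group: "group SP"
proof -
  interpret G: group "GL scl" by (rule GL_group) unfold_locales
  have "subgroup (carrier SP) (GL scl)"
  proof (rule G.subgroupI)
    show "carrier SP \<noteq> {}" using G.one_closed by (auto simp: Sp_def)
    fix f assume f: "f \<in> carrier SP"
    hence fG: "f \<in> carrier (GL scl)" by (simp add: Sp_def)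
    let ?g = "inv\<^bsub>GL scl\<^esub> f"
    have "f \<circ> ?g = id" using G.r_inv[OF fG] by simp
    hence "form (?g x) (?g y) = form x y" for x y
      using f unfolding Sp_carrier by (metis comp_apply id_apply)
    thus "?g \<in> carrier SP" using G.inv_closed[OF fG] by (simp add: Sp_def)
  next
    fix f g assume "f \<in> carrier SP" "g \<in> carrier SP"
    thus "f \<otimes>\<^bsub>GL scl\<^esub> g \<in> carrier SP" using G.m_closed[of f g] by (simp add: Sp_def)
  qed (simp add: Sp_def)
  thus ?thesis using G.subgroup_imp_group by (simp add: Sp_def)
qed

lemma Sp_simps:
  assumes "g \<in> carrier SP"
  shows "g (x + y) = g x + g y" "g (x - y) = g x - g y" "g (- x) = - g x" "g (scl a x) = scl a (g x)"
    "g 0 = 0" "form (g x) (g y) = form x y"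
  using assms unfolding Sp_carrier
  by (auto simp: module_hom.add module_hom.diff module_hom.neg module_hom.scale module_hom.zero)

end

section \<open>Siegel transformations and transvections\<close>

context symplectic_module
begin

text \<open>For isotropic orthogonal \<open>e\<close> and \<open>m\<close> this is a Siegel (or Eichler) transformation. In terms of
  the splitting into \<open>M\<close> and \<open>N\<close>, with \<open>e\<close> and \<open>m\<close> in \<open>M\<close>, it adds to \<open>x\<close> the image of \<open>x\<close> under
  the symmetric map \<open>N \<Rightarrow> M\<close> given by \<open>e \<otimes> m + m \<otimes> e + c (e \<otimes> e)\<close>. The case \<open>m = 0\<close> is a
  transvection along \<open>e\<close>.\<close>

definition siegel :: "'v \<Rightarrow> 'v \<Rightarrow> 'r \<Rightarrow> 'v \<Rightarrow> 'v" where
  "siegel e m c x = x + scl (form e x) m + scl (form m x) e + scl (c * form e x) e"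

lemma siegel_inverse:
  assumes "form e m = 0"
  shows "siegel e (- m) (- c) (siegel e m c x) = x"
  using assms form_commute[of m e] by (simp add: siegel_def form_simps algebra_simps)

lemma siegel_in_Sp:
  assumes "form e m = 0"
  shows "siegel e m c \<in> carrier SP"
  unfolding Sp_carrier
proof (intro conjI allI)
  show "Modules.module_hom scl scl (siegel e m c)"
    unfolding Modules.module_hom_iff
    by (auto simp: siegel_def form_simps algebra_simps module_axioms)
  have "siegel e m c (siegel e (- m) (- c) x) = x" for x
    using siegel_inverse[of e "- m" "- c" x] assms by (simp add: form_simps)
  thus "bij (siegel e m c)" using siegel_inverse[OF assms]
    by (intro o_bij[of "siegel e (- m) (- c)"]) auto
  show "form (siegel e m c x) (siegel e m c y) = form x y" for x y
    using assms form_commute[of m e] form_commute[of x e] form_commute[of x m]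
    by (simp add: siegel_def form_simps algebra_simps)
qed

lemma siegel_fixes_M:
  assumes "e \<in> M" "m \<in> M"
  shows "siegel e m c \<in> Sp_fix scl form M"
  using assms siegel_in_Sp[of e m c] by (auto simp: Sp_fix_def siegel_def form_M_M)

definition transvection :: "'r \<Rightarrow> 'v \<Rightarrow> 'v \<Rightarrow> 'v" where
  "transvection a z x = x + scl (a * form z x) z"

lemma transvection_siegel: "transvection a z = siegel z 0 a"
  by (auto simp: transvection_def siegel_def form_simps)

lemma transvection_in_Sp: "transvection a z \<in> carrier SP"
  by (simp add: transvection_siegel siegel_in_Sp form_simps)

lemma transvection_conjugate:
  assumes "g \<in> carrier SP"
  shows "transvection a (g z) \<circ> g = g \<circ> transvection a z"
  by (auto simp: transvection_def Sp_simps[OF assms])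

lemma subgroup_transvection_iff:
  assumes "subgroup G SP" "g \<in> G"
  shows "transvection a (g z) \<in> G \<longleftrightarrow> transvection a z \<in> G"
proof -
  interpret Sp: group SP by (rule Sp_group)
  let ?t = "transvection a z" and ?t' = "transvection a (g z)"
  have g: "g \<in> carrier SP" using assms subgroup.subset by blast
  have eq: "?t' \<otimes>\<^bsub>SP\<^esub> g = g \<otimes>\<^bsub>SP\<^esub> ?t" using transvection_conjugate[OF g] by simp
  have "?t' = g \<otimes>\<^bsub>SP\<^esub> ?t \<otimes>\<^bsub>SP\<^esub> inv\<^bsub>SP\<^esub> g"
    using eq Sp.inv_solve_right g transvection_in_Sp by (metis Sp.m_closed)
  moreover have "?t = inv\<^bsub>SP\<^esub> g \<otimes>\<^bsub>SP\<^esub> (?t' \<otimes>\<^bsub>SP\<^esub> g)"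
    using eq Sp.inv_solve_left g transvection_in_Sp by (metis Sp.m_closed)
  ultimately show ?thesis
    using assms subgroup.m_closed subgroup.m_inv_closed by metis
qed

end

section \<open>Generation of the symplectic group over a local ring\<close>

lemma (in symplectic_module) swap_images:
  assumes "s \<in> carrier SP" "\<forall>i<n. s (u i) = v i \<and> s (v i) = - u i"
  shows "m \<in> M \<Longrightarrow> s m \<in> N" "w \<in> N \<Longrightarrow> s w \<in> M" "w \<in> N \<Longrightarrow> s (s w) = - w"
proof -
  note s = Sp_simps[OF assms(1)]
  show "s m \<in> N" if "m \<in> M"
    using that by (induct rule: span_induct_alt)
      (use assms(2) in \<open>auto simp: s span_zero basis_in_span span_scale intro!: span_add\<close>)
  show "s w \<in> M" if "w \<in> N"
    using that by (induct rule: span_induct_alt)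
      (use assms(2) in \<open>auto simp: s span_zero basis_in_span span_neg span_scale intro!: span_diff\<close>)
  show "s (s w) = - w" if "w \<in> N"
    using that by (induct rule: span_induct_alt) (use assms(2) in \<open>auto simp: s\<close>)
qed

text \<open>The hypothesis is a form of locality that needs no mention of ideals: the nonunits are closed under
  addition, so in a sum that is a unit some summand is a unit.\<close>

locale local_symplectic_module = symplectic_module scl form n u v
  for scl :: "'r::comm_ring_1 \<Rightarrow> 'v::ab_group_add \<Rightarrow> 'v" and form n u v +
  assumes unit_add_nonunit: "\<And>a b :: 'r. a dvd 1 \<Longrightarrow> \<not> b dvd 1 \<Longrightarrow> a + b dvd 1"
begin

definition unimodular :: "'v \<Rightarrow> bool" where
  "unimodular z \<longleftrightarrow> (\<exists>y. form z y dvd 1)"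

lemma nonunit_add: "\<not> a dvd 1 \<Longrightarrow> \<not> b dvd 1 \<Longrightarrow> \<not> a + b dvd (1::'r)"
  using unit_add_nonunit[of "a + b" "- b"] by auto

text \<open>If all coordinates of \<open>z\<close> were nonunits, so would be every \<open>form y z\<close>, since nonunits are closed
  under addition and under multiplication by ring elements.\<close>

lemma unimodular_coordinate:
  assumes "unimodular z"
  obtains i where "i < n" "form (u i) z dvd 1 \<or> form (v i) z dvd 1"
proof -
  obtain y where y: "form y z dvd 1"
    using assms form_commute unfolding unimodular_def by (metis minus_dvd_iff)
  have "\<exists>i<n. form (u i) z dvd 1 \<or> form (v i) z dvd 1"
  proof (rule ccontr)
    assume "\<not> ?thesis"
    hence nonunit: "\<not> form b z dvd 1" if "b \<in> u ` {..<n} \<union> v ` {..<n}" for b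
      using that by auto
    have "y \<in> span (u ` {..<n} \<union> v ` {..<n})" by (simp add: span_basis)
    hence "\<not> form y z dvd 1"
    proof (induct rule: span_induct_alt)
      case base
      show ?case by (simp add: form_simps)
    next
      case (step c b y)
      have "\<not> c * form b z dvd 1" using nonunit[OF step(1)] dvd_mult_right by blast
      thus ?case using step(2) nonunit_add by (simp add: form_simps)
    qed
    thus False using y by simp
  qed
  thus ?thesis using that by blast
qed

text \<open>With \<open>a\<close> the inverse of \<open>form y x\<close>, the vector \<open>x\<close> goes to
  \<open>x + a (form (y - x) x) (y - x) = x + (y - x)\<close>.\<close>

lemma transvection_moves:
  assumes "form y x dvd 1"
  obtains a where "unimodular (y - x)" "transvection a (y - x) x = y"
proof -
  obtain a where a: "1 = form y x * a" using assms by (auto simp: dvd_def)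
  have "unimodular (y - x)" unfolding unimodular_def
    using assms by (intro exI[of _ x]) (simp add: form_simps)
  moreover have "transvection a (y - x) x = y"
    using a by (simp add: transvection_def form_simps mult.commute)
  ultimately show ?thesis using that by blast
qed

lemma transvection_fixes: "form z w = 0 \<Longrightarrow> transvection a z w = w"
  by (simp add: transvection_def)

end

text \<open>The aim is \<open>G = Sp\<close>, that is, generation of \<open>Sp\<close> by \<open>s\<close> and the fixator of \<open>M\<close>. Working with an
  arbitrary subgroup that contains these elements allows the result to be applied directly to the set
  of elements with the intertwining property.\<close>

locale swap_subgroup = local_symplectic_module scl form n u v
  for scl :: "'r::comm_ring_1 \<Rightarrow> 'v::ab_group_add \<Rightarrow> 'v" and form n u v +
  fixes s :: "'v \<Rightarrow> 'v" and G :: "('v \<Rightarrow> 'v) set"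
  assumes subgroup: "subgroup G SP"
    and swap: "\<forall>i<n. s (u i) = v i \<and> s (v i) = - u i"
    and swap_in: "s \<in> G"
    and fix_in: "Sp_fix scl form M \<subseteq> G"
begin

lemma in_Sp: "g \<in> G \<Longrightarrow> g \<in> carrier SP"
  using subgroup subgroup.subset by blast

lemma comp_in: "g \<in> G \<Longrightarrow> h \<in> G \<Longrightarrow> g \<circ> h \<in> G"
  using subgroup.m_closed[OF subgroup, of g h] by simp

lemmas swap_simps = Sp_simps[OF in_Sp[OF swap_in]]

text \<open>As \<open>s (s w) = - w\<close>, this transvection is conjugate under \<open>s\<close> to the one along \<open>- s w\<close>, which
  lies in \<open>M\<close> and so gives an element of the fixator of \<open>M\<close>.\<close>

lemma transvection_N_in:
  assumes "w \<in> N"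
  shows "transvection a w \<in> G"
proof -
  note images = swap_images[OF in_Sp[OF swap_in] swap]
  have "transvection a (- s w) \<in> G"
    using fix_in siegel_fixes_M[of "- s w" 0] images(2)[OF assms] span_neg span_zero
    unfolding transvection_siegel by blast
  hence "transvection a (s (- s w)) \<in> G"
    using subgroup_transvection_iff[OF subgroup swap_in] by blast
  thus ?thesis using images(3)[OF assms] by (simp add: swap_simps)
qed

text \<open>A Siegel transformation that fixes \<open>M\<close> removes the \<open>M\<close>-component of \<open>z\<close>; this needs some \<open>e\<close> in \<open>M\<close>
  with \<open>form e z = 1\<close>, which the unit coordinate provides.\<close>

lemma transvection_in_if_u_coordinate:
  assumes i: "i < n" and unit: "form (u i) z dvd 1"
  shows "transvection a z \<in> G"
proof -
  obtain m w where mw: "m \<in> M" "w \<in> N" "z = m + w" by (rule M_N_decomposition)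
  obtain b where b: "1 = form (u i) z * b" using unit by (auto simp: dvd_def)
  define e where "e = scl b (u i)"
  have e: "e \<in> M" unfolding e_def using i by (auto intro: span_scale span_base)
  have ez: "form e z = 1" unfolding e_def using b by (simp add: form_simps mult.commute)
  \<comment> \<open>The coefficient \<open>form m z\<close> cancels the multiple of \<open>e\<close> that comes from \<open>form (- m) z\<close>.\<close>
  let ?g = "siegel e (- m) (form m z)"
  have "?g z = w" using mw(3) ez by (simp add: siegel_def form_simps)
  moreover have "?g \<in> G"
    using siegel_fixes_M[of e "- m"] e mw(1) span_neg fix_in by blast
  ultimately show ?thesis
    using subgroup_transvection_iff[OF subgroup] transvection_N_in[OF mw(2)] by metis
qed

text \<open>Up to conjugation by \<open>s\<close>, which exchanges the two kinds of coordinates up to sign, the unit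
  coordinate of \<open>z\<close> is the one of the preceding lemma.\<close>

lemma transvection_in:
  assumes "unimodular z"
  shows "transvection a z \<in> G"
proof -
  obtain i where i: "i < n" "form (u i) z dvd 1 \<or> form (v i) z dvd 1"
    using unimodular_coordinate[OF assms] .
  show ?thesis
  proof (cases "form (u i) z dvd 1")
    case True
    thus ?thesis using transvection_in_if_u_coordinate i(1) by blast
  next
    case False
    have "form (u i) (s z) = - form (s (v i)) (s z)" using swap i(1) by (simp add: form_simps)
    hence "form (u i) (s z) dvd 1" using False i by (simp add: swap_simps)
    hence "transvection a (s z) \<in> G" using transvection_in_if_u_coordinate i(1) by blast
    thus ?thesis using subgroup_transvection_iff[OF subgroup swap_in] by blast
  qed
qed

lemma move:
  assumes "form y x dvd 1"
  shows "\<exists>t\<in>G. t x = y \<and> (\<forall>w. form x w = form y w \<longrightarrow> t w = w)"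
proof -
  obtain a where a: "unimodular (y - x)" "transvection a (y - x) x = y"
    using transvection_moves[OF assms] .
  have "transvection a (y - x) w = w" if "form x w = form y w" for w
    using that by (simp add: form_simps transvection_fixes)
  thus ?thesis using transvection_in[OF a(1)] a(2) by blast
qed

lemma move_via:
  assumes "form p x dvd 1" "form y p dvd 1"
  shows "\<exists>t\<in>G. t x = y \<and> (\<forall>w. form x w = form p w \<and> form p w = form y w \<longrightarrow> t w = w)"
proof -
  obtain t where t: "t \<in> G" "t x = p" "\<forall>w. form x w = form p w \<longrightarrow> t w = w"
    using move[OF assms(1)] by blast
  obtain t' where t': "t' \<in> G" "t' p = y" "\<forall>w. form p w = form y w \<longrightarrow> t' w = w"
    using move[OF assms(2)] by blast
  show ?thesis
    by (rule bexI[OF _ comp_in[OF t'(1) t(1)]]) (simp add: t t')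
qed

text \<open>First \<open>x\<close> is carried to \<open>a\<close>, then the image \<open>y'\<close> of \<open>y\<close> to \<open>b\<close> by transvections that fix \<open>a\<close>. The
  latter are along vectors orthogonal to \<open>a\<close>, because \<open>y'\<close>, \<open>b\<close> and the intermediate vector
  \<open>a + b\<close> all have the same pairing with \<open>a\<close>.\<close>

lemma hyperbolic_pair_transitive:
  assumes xy: "form x y = 1" and ab: "form a b = 1"
  obtains t where "t \<in> G" "t x = a" "t y = b"
    "\<And>w. form x w = 0 \<Longrightarrow> form y w = 0 \<Longrightarrow> form a w = 0 \<Longrightarrow> form b w = 0 \<Longrightarrow> t w = w"
proof -
  have yx: "form y x = -1" and ba: "form b a = -1"
    using xy ab form_commute[of y x] form_commute[of b a] by auto
  \<comment> \<open>If neither \<open>b\<close> nor \<open>y\<close> can serve, both \<open>form b x\<close> and \<open>form a y\<close> are nonunits, and \<open>y + b\<close> works.\<close>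
  have "\<exists>p \<in> {b, y, y + b}. form p x dvd 1 \<and> form a p dvd 1"
  proof (cases "form b x dvd 1 \<or> form a y dvd 1")
    case False
    hence "form (y + b) x dvd 1 \<and> form a (y + b) dvd 1"
      using unit_add_nonunit[of "-1" "form b x"] unit_add_nonunit[of 1 "form a y"] yx ab
      by (simp add: form_simps add.commute)
    thus ?thesis by blast
  qed (use yx ab in auto)
  then obtain p where p: "p \<in> {b, y, y + b}" "form p x dvd 1" "form a p dvd 1" by blast
  obtain t where t: "t \<in> G" "t x = a"
      "\<forall>w. form x w = form p w \<and> form p w = form a w \<longrightarrow> t w = w"
    using move_via[OF p(2,3)] by blast
  define y' where "y' = t y"
  have y': "form a y' = 1" using Sp_simps(6)[OF in_Sp[OF t(1)], of x y] xy t(2) y'_def by simp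
  hence y'a: "form y' a = -1" using form_commute[of y' a] by simp
  have "\<exists>t'\<in>G. t' y' = b
      \<and> (\<forall>w. form y' w = form (a + b) w \<and> form (a + b) w = form b w \<longrightarrow> t' w = w)"
  proof (cases "form b y' dvd 1")
    case True
    thus ?thesis using move[OF True] by auto
  next
    case False
    hence via: "form (a + b) y' dvd 1" "form b (a + b) dvd 1"
      using unit_add_nonunit[of 1] y' ba by (simp_all add: form_simps)
    show ?thesis by (rule move_via[OF via])
  qed
  then obtain t' where t': "t' \<in> G" "t' y' = b"
      "\<forall>w. form y' w = form (a + b) w \<and> form (a + b) w = form b w \<longrightarrow> t' w = w" by blast
  have "(t' \<circ> t) w = w" if w: "form x w = 0" "form y w = 0" "form a w = 0" "form b w = 0" for w
  proof -
    have tw: "t w = w" using t(3) p(1) w by (auto simp: form_simps)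
    have "form y' w = form (t y) (t w)" using tw y'_def by simp
    hence "form y' w = 0" using Sp_simps(6)[OF in_Sp[OF t(1)]] w(2) by simp
    thus ?thesis using t'(3) w tw by (simp add: form_simps)
  qed
  moreover have "t' a = a" using t'(3) y'a ba by (simp add: form_simps)
  ultimately show ?thesis
    using that[OF comp_in[OF t'(1) t(1)]] t(2) t'(2) y'_def by simp
qed

text \<open>Induction on the number \<open>k\<close> of basis pairs at the end of the list that \<open>g\<close> may move. The pair at
  index \<open>n - k\<close> is put back by an element of \<open>G\<close> that fixes the earlier basis vectors, since these are
  orthogonal to the pair and to its image under \<open>g\<close>.\<close>

lemma basis_stabilizer_in:
  assumes "k \<le> n" "g \<in> carrier SP" "\<And>i. i < n - k \<Longrightarrow> g (u i) = u i \<and> g (v i) = v i"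
  shows "g \<in> G"
  using assms
proof (induct k arbitrary: g)
  case 0
  note g = Sp_simps[OF 0(2)]
  have "g x = x" for x
  proof -
    have "form (u i) (g x) = form (u i) x \<and> form (v i) (g x) = form (v i) x" if "i < n" for i
      using g(6)[of "u i" x] g(6)[of "v i" x] 0(3) that by simp
    thus ?thesis using basis_eqI by blast
  qed
  hence "g = id" by auto
  thus ?case using subgroup.one_closed[OF subgroup] by (simp only: Sp_one)
next
  case (Suc k)
  define i where "i = n - Suc k"
  have i: "i < n" using Suc(2) i_def by simp
  note g = Sp_simps[OF Suc(3)]
  obtain t where t: "t \<in> G" "t (g (u i)) = u i" "t (g (v i)) = v i"
      "\<And>w. form (g (u i)) w = 0 \<Longrightarrow> form (g (v i)) w = 0 \<Longrightarrow> form (u i) w = 0 \<Longrightarrow> form (v i) w = 0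
        \<Longrightarrow> t w = w"
    using hyperbolic_pair_transitive[of "g (u i)" "g (v i)" "u i" "v i"] g(6) form_basis(1)[OF i i]
    by metis
  have "(t \<circ> g) (u j) = u j \<and> (t \<circ> g) (v j) = v j" if j: "j < n - k" for j
  proof (cases "j = i")
    case True
    thus ?thesis using t by simp
  next
    case False
    hence ji: "j < i" using j i_def by simp
    hence gj: "g (u j) = u j" "g (v j) = v j" using Suc(4) i_def by auto
    have "form (u i) w = 0 \<and> form (v i) w = 0" if "w \<in> {u j, v j}" for w
      using that ji i by (auto simp: form_basis)
    thus ?thesis using t(4)[of "u j"] t(4)[of "v j"] gj g(6)
      by (metis comp_apply insertCI)
  qed
  hence fixed: "\<And>j. j < n - k \<Longrightarrow> (t \<circ> g) (u j) = u j \<and> (t \<circ> g) (v j) = v j" .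
  have tg_Sp: "t \<circ> g \<in> carrier SP"
    using group.subgroup_self[OF Sp_group] subgroup.m_closed[of "carrier SP" SP t g]
      in_Sp[OF t(1)] Suc(3) by simp
  have tg: "t \<circ> g \<in> G" by (rule Suc(1)[OF Suc_leD[OF Suc(2)] tg_Sp fixed])
  interpret Sp: group SP by (rule Sp_group)
  have "inv\<^bsub>SP\<^esub> t \<otimes>\<^bsub>SP\<^esub> (t \<otimes>\<^bsub>SP\<^esub> g) = g"
    using Sp.inv_solve_left' in_Sp[OF t(1)] Suc(3) Sp.m_closed by metis
  moreover have "inv\<^bsub>SP\<^esub> t \<otimes>\<^bsub>SP\<^esub> (t \<otimes>\<^bsub>SP\<^esub> g) \<in> G"
    using subgroup.m_closed[OF subgroup subgroup.m_inv_closed[OF subgroup t(1)]] tg by simp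
  ultimately show ?case by simp
qed

lemma swap_subgroup_eq_Sp: "G = carrier SP"
  using basis_stabilizer_in[of n] in_Sp by auto

end

section \<open>Intertwining operators of the Schroedinger representation\<close>

locale schroedinger_model = symplectic_module scl form n u v + X: vector_space sclX
  for scl :: "'r::comm_ring_1 \<Rightarrow> 'v::ab_group_add \<Rightarrow> 'v" and form n u v
    and sclX :: "complex \<Rightarrow> 'x::ab_group_add \<Rightarrow> 'x" +
  fixes lam :: "'r \<Rightarrow> complex" and e :: "'v \<Rightarrow> 'x" and S :: "'r \<times> 'v \<Rightarrow> 'x \<Rightarrow> 'x"
  assumes lam_add: "lam (a + b) = lam a * lam b"
    and spanning: "X.span (e ` N) = UNIV"
    and schroedinger: "schroedinger_rep lam form M N sclX e S"
begin

lemma S_carrier: "S h \<in> carrier (GL sclX)"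
  using schroedinger unfolding schroedinger_rep_def heisenberg_def hom_def by auto

lemma S_simps:
  "S h (x + y) = S h x + S h y"  "S h (sclX c x) = sclX c (S h x)"
  "S h (sum f I) = (\<Sum>i\<in>I. S h (f i))"
  using S_carrier[of h] unfolding GL_carrier
  by (auto simp: module_hom.add module_hom.scale module_hom.sum)

lemma S_mult: "S (r, x) (S (t, y) z) = S (r + t + form x y, x + y) z"
proof -
  have "S ((r, x) \<otimes>\<^bsub>heisenberg form\<^esub> (t, y)) = S (r, x) \<otimes>\<^bsub>GL sclX\<^esub> S (t, y)"
    using schroedinger unfolding schroedinger_rep_def
    by (intro hom_mult[of S "heisenberg form"]) (auto simp: heisenberg_def)
  thus ?thesis by (simp add: heisenberg_def)
qed

lemma S_basis:
  assumes "x \<in> N"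
  shows "w \<in> N \<Longrightarrow> S (0, w) (e x) = e (x + w)"
    and "m \<in> M \<Longrightarrow> S (0, m) (e x) = sclX (lam (2 * form m x)) (e x)"
    and "S (r, 0) (e x) = sclX (lam r) (e x)"
  using schroedinger assms unfolding schroedinger_rep_def by blast+

lemma hom_eqI:
  assumes "Modules.module_hom sclX sclX f" "Modules.module_hom sclX sclX g"
    and "\<And>x. x \<in> N \<Longrightarrow> f (e x) = g (e x)"
  shows "f y = g y"
proof -
  interpret module_pair sclX sclX by unfold_locales
  show ?thesis
    by (rule module_hom_eq_on_span[OF assms(1,2), of "e ` N"]) (use assms(3) spanning in auto)
qed

lemma S_center: "S (r, 0) x = sclX (lam r) x"
proof (rule hom_eqI[of "S (r, 0)"])
  show "Modules.module_hom sclX sclX (sclX (lam r))"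
    unfolding Modules.module_hom_iff
    by (simp add: X.module_axioms X.scale_right_distrib X.scale_left_commute)
qed (use S_carrier[of "(r, 0)"] in \<open>simp_all add: GL_carrier S_basis(3)\<close>)

text \<open>Comparison with the Heisenberg product \<open>(0, y) (0, z) = (form y z, y + z)\<close>; the surplus in the
  centre is removed by the scalar.\<close>

lemma S_split: "S (r, y + z) x = sclX (lam (r - form y z)) (S (0, y) (S (0, z) x))"
  unfolding S_center[symmetric] S_mult by (simp add: form_simps)

definition intertwines :: "('v \<Rightarrow> 'v) \<Rightarrow> ('x \<Rightarrow> 'x) \<Rightarrow> bool" where
  "intertwines g A \<longleftrightarrow> (\<forall>r y x. A (S (r, y) x) = S (r, g y) (A x))"

text \<open>Both sides are linear in the vector and, by \<open>S_split\<close>, multiplicative in the Heisenberg element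
  with the same central scalar, because \<open>g\<close> preserves the form.\<close>

lemma intertwinesI:
  assumes g: "g \<in> carrier SP" and A: "Modules.module_hom sclX sclX A"
    and N: "\<And>x w. x \<in> N \<Longrightarrow> w \<in> N \<Longrightarrow> A (S (0, w) (e x)) = S (0, g w) (A (e x))"
    and M: "\<And>x m. x \<in> N \<Longrightarrow> m \<in> M \<Longrightarrow> A (S (0, m) (e x)) = S (0, g m) (A (e x))"
  shows "intertwines g A"
  unfolding intertwines_def
proof (intro allI)
  have S: "Modules.module_hom sclX sclX (S h)" for h using S_carrier GL_carrier by blast
  have hom: "Modules.module_hom sclX sclX (\<lambda>x. A (S h x))"
      "Modules.module_hom sclX sclX (\<lambda>x. S h (A x))" for h
    using module_hom_compose[OF S A] module_hom_compose[OF A S] by (simp_all add: o_def)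
  have *: "A (S (0, y) x) = S (0, g y) (A x)" if "y \<in> N \<or> y \<in> M" for x y
    by (rule hom_eqI[OF hom]) (use that N M in auto)
  fix r y x
  obtain m w where mw: "m \<in> M" "w \<in> N" "y = m + w" by (rule M_N_decomposition)
  have "A (S (r, y) x) = sclX (lam (r - form m w)) (S (0, g m) (S (0, g w) (A x)))"
    unfolding mw(3) S_split using mw * by (simp add: module_hom.scale[OF A])
  also have "\<dots> = S (r, g y) (A x)"
    unfolding mw(3) Sp_simps(1)[OF g] S_split by (simp add: Sp_simps(6)[OF g])
  finally show "A (S (r, y) x) = S (r, g y) (A x)" .
qed

text \<open>Here \<open>g x - x\<close> lies in \<open>M\<close> for every \<open>x\<close>, as \<open>M\<close> is its own orthogonal complement. Hence
  \<open>Q x = form (g x) x\<close> is a quadratic form on \<open>N\<close> with symmetric polar part \<open>form (g x) w\<close>, and the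
  relation for \<open>w\<close> in \<open>N\<close> is the formula for \<open>Q (x + w)\<close>.\<close>

lemma intertwines_Sp_fix:
  assumes g: "g \<in> Sp_fix scl form M" and A: "Modules.module_hom sclX sclX A"
    and Ae: "\<And>x. x \<in> N \<Longrightarrow> A (e x) = sclX (lam (form (g x) x)) (e x)"
  shows "intertwines g A"
proof -
  have gSp: "g \<in> carrier SP" and fix_M: "\<And>m. m \<in> M \<Longrightarrow> g m = m"
    using g unfolding Sp_fix_def by auto
  note g_simps = Sp_simps[OF gSp]
  have diff_M: "g x - x \<in> M" for x
  proof (rule M_maximal_isotropic)
    fix m assume "m \<in> M"
    thus "form m (g x - x) = 0" using g_simps(6)[of m x] fix_M by (simp add: form_simps)
  qed
  show ?thesis
  proof (rule intertwinesI[OF gSp A])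
    fix x w assume x: "x \<in> N" and w: "w \<in> N"
    define m where "m = g w - w"
    have m: "m \<in> M" unfolding m_def by (rule diff_M)
    have "form (g x) m = form x m" using g_simps(6)[of x m] fix_M[OF m] by simp
    moreover have "form (g x) (g w) = 0" using g_simps(6) form_N_N x w by simp
    ultimately have sym: "form (g x) w = form (g w) x"
      using form_N_N[OF x w] form_commute[of x "g w"] by (simp add: m_def form_simps)
    have "form (g (x + w)) (x + w) = (0 - form w m) + 2 * form m x + form (g x) x"
      using sym form_N_N[OF w x] form_commute[of w "g w"] unfolding m_def
      by (simp add: form_simps g_simps)
    hence "lam (form (g (x + w)) (x + w))
        = lam (0 - form w m) * lam (2 * form m x) * lam (form (g x) x)"
      by (simp only: lam_add)
    moreover have "g w = w + m" by (simp add: m_def)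
    ultimately show "A (S (0, w) (e x)) = S (0, g w) (A (e x))"
      using x w m by (simp add: S_split S_basis S_simps Ae span_add mult_ac)
  next
    fix x m assume "x \<in> N" "m \<in> M"
    thus "A (S (0, m) (e x)) = S (0, g m) (A (e x))"
      by (simp add: S_basis S_simps Ae fix_M module_hom.scale[OF A] mult.commute)
  qed
qed

text \<open>The operator is a Fourier transform on \<open>N\<close>: it turns the translation by \<open>w\<close> in \<open>N\<close> into
  multiplication by a character, which is how \<open>s w\<close> in \<open>M\<close> acts, and it turns multiplication by the
  character of \<open>m\<close> in \<open>M\<close> into the translation by \<open>s m\<close>.\<close>

lemma intertwines_swap:
  assumes s: "s \<in> carrier SP" "\<forall>i<n. s (u i) = v i \<and> s (v i) = - u i"
    and A: "Modules.module_hom sclX sclX A"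
    and Ae: "\<And>x. x \<in> N \<Longrightarrow> A (e x) =
      sclX c (\<Sum>w\<in>N. sclX (lam (- 2 * (\<Sum>i<n. form (u i) w * form (u i) x))) (e w))"
  shows "intertwines s A"
proof -
  note s_simps = Sp_simps[OF s(1)] and images = swap_images[OF s]
  have s_hom: "Modules.module_hom scl scl s" using s(1) Sp_carrier by blast
  define dot where "dot w x = (\<Sum>i<n. form (u i) w * form (u i) x)" for w x
  have dot_add: "dot (w + w') x = dot w x + dot w' x" "dot w (x + x') = dot w x + dot w x'"
    for w w' x x'
    by (simp_all add: dot_def form_simps sum.distrib algebra_simps)
  have Ae': "A (e x) = sclX c (\<Sum>w\<in>N. sclX (lam (- 2 * dot w x)) (e w))" if "x \<in> N" for x
    using Ae[OF that] by (simp add: dot_def)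
  have form_sN: "form (s w) x = - dot w x" if "w \<in> N" for w x
  proof -
    have "s w = (\<Sum>i<n. s (scl (form (u i) w) (v i)))"
      using N_expansion[OF that] module_hom.sum[OF s_hom] by metis
    thus ?thesis using s(2) by (simp add: s_simps form_sum form_simps dot_def sum_negf)
  qed
  have form_M: "form m x = dot x (s m)" if "m \<in> M" "x \<in> N" for m x
    using s_simps(6)[of m x] form_sN[OF that(2), of "s m"] form_commute[of "s m" "s x"] by simp
  show ?thesis
  proof (rule intertwinesI[OF s(1) A])
    fix x w assume x: "x \<in> N" and w: "w \<in> N"
    have "lam (2 * form (s w) y) * lam (- 2 * dot y x) = lam (- 2 * dot y (x + w))" for y
    proof -
      have "dot w y = dot y w" unfolding dot_def by (simp add: mult.commute)
      thus ?thesis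
        by (simp add: lam_add[symmetric] form_sN[OF w] dot_add algebra_simps)
    qed
    thus "A (S (0, w) (e x)) = S (0, s w) (A (e x))"
      using x w images(2)[OF w]
      by (simp add: Ae' S_basis S_simps span_add mult.commute)
  next
    fix x m assume x: "x \<in> N" and m: "m \<in> M"
    note sm = images(1)[OF m]
    have "S (0, s m) (A (e x)) = sclX c (\<Sum>y\<in>N. sclX (lam (- 2 * dot y x)) (e (y + s m)))"
      using x sm by (simp add: Ae' S_simps S_basis)
    also have "(\<Sum>y\<in>N. sclX (lam (- 2 * dot y x)) (e (y + s m)))
        = (\<Sum>y\<in>N. sclX (lam (2 * form m x)) (sclX (lam (- 2 * dot y x)) (e y)))"
    proof (rule sum.reindex_bij_witness[of _ "\<lambda>y. y - s m" "\<lambda>y. y + s m"])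
      fix y
      have "form m x = dot (s m) x" using form_M[OF m x] by (simp add: dot_def mult.commute)
      thus "sclX (lam (2 * form m x)) (sclX (lam (- 2 * dot (y + s m) x)) (e (y + s m)))
          = sclX (lam (- 2 * dot y x)) (e (y + s m))"
        by (simp add: lam_add[symmetric] dot_add algebra_simps)
    qed (use sm in \<open>auto intro: span_add span_diff\<close>)
    also have "sclX c \<dots> = A (S (0, m) (e x))"
      using x m by (simp add: S_basis module_hom.scale[OF A] Ae' X.scale_sum_right mult_ac)
    finally show "A (S (0, m) (e x)) = S (0, s m) (A (e x))" by simp
  qed
qed

lemma subgroup_intertwines:
  assumes W: "W \<in> hom SP (GL sclX)"
  shows "subgroup {g \<in> carrier SP. intertwines g (W g)} SP"
proof -
  interpret Sp: group SP by (rule Sp_group)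
  interpret GL: group "GL sclX" by (rule GL_group) unfold_locales
  interpret W: group_hom SP "GL sclX" W by unfold_locales (rule W)
  show ?thesis
  proof (rule Sp.subgroupI)
    have "intertwines id id" by (simp add: intertwines_def)
    thus "{g \<in> carrier SP. intertwines g (W g)} \<noteq> {}"
      using Sp.one_closed W.hom_one unfolding Sp_one GL_one by force
    fix g assume g: "g \<in> {g \<in> carrier SP. intertwines g (W g)}"
    let ?h = "inv\<^bsub>SP\<^esub> g"
    have "W g \<circ> W ?h = id" "W ?h \<circ> W g = id" "g \<circ> ?h = id"
      using W.hom_inv[of g] GL.r_inv[of "W g"] GL.l_inv[of "W g"] Sp.r_inv[of g] g by simp_all
    hence Wgh: "W g (W ?h x) = x" and Whg: "W ?h (W g x) = x" and ghx: "g (?h y) = y" for x y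
      by (simp_all only: o_def id_def fun_eq_iff)
    have "W ?h (S (r, y) x) = S (r, ?h y) (W ?h x)" for r y x
    proof -
      have "W g (S (r, ?h y) (W ?h x)) = S (r, y) x"
        using g Wgh ghx unfolding intertwines_def by simp
      thus ?thesis using Whg by metis
    qed
    thus "?h \<in> {g \<in> carrier SP. intertwines g (W g)}"
      using g Sp.inv_closed unfolding intertwines_def by simp
  next
    fix g h assume gh: "g \<in> {g \<in> carrier SP. intertwines g (W g)}"
      "h \<in> {g \<in> carrier SP. intertwines g (W g)}"
    hence "W (g \<circ> h) = W g \<circ> W h" "g \<circ> h \<in> carrier SP"
      using W.hom_mult[of g h] Sp.m_closed[of g h] by simp_all
    thus "g \<otimes>\<^bsub>SP\<^esub> h \<in> {g \<in> carrier SP. intertwines g (W g)}"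
      using gh unfolding intertwines_def by simp
  qed auto
qed

lemma weil_repI:
  assumes W: "W \<in> hom SP (GL sclX)" and "\<And>g. g \<in> carrier SP \<Longrightarrow> intertwines g (W g)"
  shows "weil_rep scl form sclX S W"
  unfolding weil_rep_def
proof (intro conjI ballI W)
  interpret GL: group "GL sclX" by (rule GL_group) unfold_locales
  fix g h assume g: "g \<in> carrier SP"
  have Wg: "W g \<in> carrier (GL sclX)" using W g by (auto simp: hom_def)
  have "W g \<otimes>\<^bsub>GL sclX\<^esub> S h = S (heisenberg_act g h) \<otimes>\<^bsub>GL sclX\<^esub> W g"
    using assms(2)[OF g] by (cases h) (auto simp: intertwines_def heisenberg_act_def)
  thus "W g \<otimes>\<^bsub>GL sclX\<^esub> S h \<otimes>\<^bsub>GL sclX\<^esub> inv\<^bsub>GL sclX\<^esub> (W g) = S (heisenberg_act g h)"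
    using GL.inv_solve_right' Wg S_carrier GL.m_closed by metis
qed

end

section \<open>Finite local rings\<close>

lemma finite_ideal_in_maximal:
  fixes I :: "'r::{comm_ring_1,finite} set"
  assumes "is_ideal I" "I \<noteq> UNIV"
  shows "\<exists>J. is_maximal_ideal J \<and> I \<subseteq> J"
proof -
  let ?A = "{J. is_ideal J \<and> I \<subseteq> J \<and> J \<noteq> UNIV}"
  have "finite ?A" by simp
  moreover have "?A \<noteq> {}" using assms by blast
  ultimately have "\<exists>J\<in>?A. \<forall>K\<in>?A. J \<subseteq> K \<longrightarrow> J = K" by (rule finite_has_maximal)
  then obtain J where J: "J \<in> ?A" and max: "\<forall>K\<in>?A. J \<subseteq> K \<longrightarrow> J = K" ..
  have "K = J \<or> K = UNIV" if "is_ideal K" "J \<subseteq> K" for K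
  proof (cases "K = UNIV")
    case False
    hence "K \<in> ?A" using J that by auto
    hence "J = K" by (rule max[rule_format, OF _ that(2)])
    thus ?thesis by simp
  qed simp
  hence "is_maximal_ideal J" using J by (simp add: is_maximal_ideal_def)
  thus ?thesis using J by (intro exI[of _ J]) simp
qed

text \<open>A nonunit generates a proper ideal, so it lies in the maximal ideal. Were \<open>a + b\<close> a nonunit too,
  the unit \<open>a = (a + b) - b\<close> would lie in that ideal.\<close>

lemma local_ring_unit_add_nonunit:
  fixes a b :: "'r::{comm_ring_1,finite}"
  assumes local: "\<exists>!I::'r set. is_maximal_ideal I" and a: "a dvd 1" and b: "\<not> b dvd 1"
  shows "a + b dvd 1"
proof (rule ccontr)
  interpret R: Modules.module "(*) :: 'r \<Rightarrow> 'r \<Rightarrow> 'r"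
    by unfold_locales (simp_all add: algebra_simps)
  have principal: "\<exists>J. is_maximal_ideal J \<and> x \<in> J" if "\<not> x dvd 1" for x :: 'r
  proof -
    have ideal: "is_ideal (R.span {x})" unfolding is_ideal_def by (rule R.subspace_span)
    have "1 \<notin> R.span {x}"
      using that unfolding R.span_singleton by (auto simp: dvd_def mult.commute)
    hence "R.span {x} \<noteq> UNIV" by (metis UNIV_I)
    then obtain J where "is_maximal_ideal J" "R.span {x} \<subseteq> J"
      using finite_ideal_in_maximal[OF ideal] by auto
    thus ?thesis using R.span_base[of x "{x}"] by auto
  qed
  assume "\<not> a + b dvd 1"
  then obtain J where J: "is_maximal_ideal J" "a + b \<in> J"
    using principal[of "a + b"] by blast
  obtain K where K: "is_maximal_ideal K" "b \<in> K" using principal[OF b] by blast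
  have "K = J" using local K(1) J(1) by (elim ex1E) metis
  hence "b \<in> J" using K(2) by simp
  have sub: "R.subspace J" using J(1) unfolding is_maximal_ideal_def is_ideal_def by blast
  have "a \<in> J" using R.subspace_diff[OF sub J(2) \<open>b \<in> J\<close>] by simp
  moreover obtain a' where "1 = a * a'" using a by (auto simp: dvd_def)
  ultimately have "1 \<in> J" using R.subspace_scale[OF sub, of a a'] by (simp add: mult.commute)
  hence "x \<in> J" for x using R.subspace_scale[OF sub, of 1 x] by simp
  hence "J = UNIV" by auto
  thus False using J(1) unfolding is_maximal_ideal_def by blast
qed

section \<open>The Weil representation\<close>

theorem theorem7p4:
  fixes lam :: "'r::{comm_ring_1,finite} \<Rightarrow> complex"
    and \<mm> :: "'r set"
    and q d n :: nat
    and scl :: "'r \<Rightarrow> 'v::ab_group_add \<Rightarrow> 'v"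
    and form :: "'v \<Rightarrow> 'v \<Rightarrow> 'r"
    and u v :: "nat \<Rightarrow> 'v"
    and M N :: "'v set"
    and s :: "'v \<Rightarrow> 'v"
    and sclX :: "complex \<Rightarrow> 'x::ab_group_add \<Rightarrow> 'x"
    and e :: "'v \<Rightarrow> 'x"
    and S :: "'r \<times> 'v \<Rightarrow> 'x \<Rightarrow> 'x"
    and W :: "('v \<Rightarrow> 'v) \<Rightarrow> 'x \<Rightarrow> 'x"
  assumes local_ring: "\<exists>!I::'r set. is_maximal_ideal I"
    and two_unit: "(2::'r) dvd 1"
    and unique_minimal: "\<exists>!I::'r set. is_minimal_ideal I"
    and "is_maximal_ideal \<mm>"
    and residue_field: "q = card (quotient_set \<mm>)"
    and card_R: "card (UNIV :: 'r set) = q ^ d"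
    and "q > 3"
    and "primitive_char lam"
    and "n \<ge> 1"
    and "Modules.module scl"
    and "nondegenerate_alternating scl form"
    and "symplectic_basis scl form n u v"
    and M: "M = Modules.module.span scl (u ` {..<n})"
    and N: "N = Modules.module.span scl (v ` {..<n})"
    and s: "s \<in> carrier (Sp scl form)" "\<forall>i<n. s (u i) = v i \<and> s (v i) = - u i"
    and X: "vector_space sclX" "inj_on e N"
      "\<not> Modules.module.dependent sclX (e ` N)" "Modules.module.span sclX (e ` N) = UNIV"
    and S: "schroedinger_rep lam form M N sclX e S"
    and W: "W \<in> hom (Sp scl form) (GL sclX)"
      "W_formulas d lam scl form n u v M N s sclX e W"
  shows "weil_rep scl form sclX S W"
proof -
  interpret symplectic_module scl form n u v
    using \<open>Modules.module scl\<close> \<open>nondegenerate_alternating scl form\<close> \<open>symplectic_basis scl form n u v\<close>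
    by (simp add: symplectic_module_def symplectic_module_axioms_def)
  interpret local_symplectic_module scl form n u v
    by unfold_locales (rule local_ring_unit_add_nonunit[OF local_ring])
  interpret X: vector_space sclX by (rule X(1))
  interpret schroedinger_model scl form n u v sclX lam e S
    using \<open>primitive_char lam\<close> X(4) S
    by unfold_locales (auto simp: primitive_char_def M N)
  let ?G = "{g \<in> carrier (Sp scl form). intertwines g (W g)}"
  note formulas = W(2)[unfolded W_formulas_def, rule_format]
  have W_hom: "Modules.module_hom sclX sclX (W g)" if "g \<in> carrier (Sp scl form)" for g
    using hom_in_carrier[OF W(1) that] unfolding GL_carrier by (rule conjunct1)
  have fix_sub: "Sp_fix scl form M \<subseteq> ?G"
  proof
    fix g assume g: "g \<in> Sp_fix scl form M"
    hence gSp: "g \<in> carrier (Sp scl form)" by (simp add: Sp_fix_def)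
    have "W g (e x) = sclX (lam (form (g x) x)) (e x)" if "x \<in> N" for x
      using formulas[OF that] g by blast
    hence "intertwines g (W g)"
      by (intro intertwines_Sp_fix g[unfolded M] W_hom gSp) (simp add: N)
    thus "g \<in> ?G" using gSp by simp
  qed
  have "intertwines s (W s)"
  proof (rule intertwines_swap[OF s W_hom[OF s(1)]])
    show "W s (e x) = sclX (inverse (gauss_sum lam ^ n))
        (\<Sum>w\<in>span (v ` {..<n}). sclX (lam (- 2 * (\<Sum>i<n. form (u i) w * form (u i) x))) (e w))"
      if "x \<in> span (v ` {..<n})" for x
      using formulas[of x] that unfolding N by blast
  qed
  hence s_in: "s \<in> ?G" using s(1) by simp
  interpret swap_subgroup scl form n u v s ?G
    by (intro swap_subgroup.intro swap_subgroup_axioms.intro local_symplectic_module_axioms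
        subgroup_intertwines W(1) s(2) s_in fix_sub[unfolded M])
  show ?thesis
    by (rule weil_repI[OF W(1)]) (use swap_subgroup_eq_Sp in blast)
qed

end
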